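(* Let $X$ be a nonempty second-countable Hausdorff space and let $S$ be a dyadic subbase of $X$. Then $\widehat{K}_S$ is a cusl (conditional upper semilattice with least element), and therefore $\widehat{D}_S$ is a bounded complete domain.
   Context: $\mathbb{T}=\{0,1,\bot\}$ is ordered by $\bot\sqsubseteq 0$, $\bot\sqsubseteq 1$, and $\mathbb{T}^\omega$ (infinite sequences over $\mathbb{T}$) carries the product order $\sqsubseteq$. For $p\in\mathbb{T}^\omega$ and $m\in\mathbb{N}$, $p|_m\in\mathbb{T}^\omega$ is defined by $p|_m(k)=p(k)$ if $k<m$ and $p|_m(k)=\bot$ if $k\ge m$. A dyadic subbase of $X$ is a family $S=\{S_{n,a}: n\in\mathbb{N}, a\in\{0,1\}\}$ of regular open sets (open sets equal to the interior of their closure) that forms a subbase of $X$ and such that $S_{n,1}$ is the exterior (complement of the closure) of $S_{n,0}$ for each $n$. Put $S_{n,\bot}=X\setminus(S_{n,0}\cup S_{n,1})$. For $x\in X$, $\tilde{x}\in\mathbb{T}^\omega$ is given by $\tilde{x}(n)=c$ iff $x\in S_{n,c}$ ($c\in\mathbb{T}$), $\widetilde{X}=\{\tilde{x}:x\in X\}$, and $\uparrow\widetilde{X}=\{p\in\mathbb{T}^\omega: p\sqsupseteq\tilde{x}\text{ for some }x\in X\}$. $\widehat{K}_S=\{p|_m:p\in\uparrow\widetilde{X},m\in\mathbb{N}\}$, ordered by $\sqsubseteq$, and $\widehat{D}_S=\mathrm{Idl}(\widehat{K}_S)$ is its ideal completion: the poset of ideals (directed downwards-closed subsets) of $\widehat{K}_S$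 ordered by inclusion. A poset is a cusl if it has a least element and every pair of elements having a common upper bound has a least upper bound. A domain is an $\omega$-algebraic pointed dcpo. A poset is bounded complete if every subset which has an upper bound has a least upper bound. *)

theory Defs
  imports "HOL-Analysis.Analysis" "HOL-Algebra.Order"
begin

text \<open>Here \<open>closure_of\<close> is the topological closure, not the one of \<open>HOL-Algebra\<close>.\<close>

no_notation eq_closure_of (\<open>closure'_of\<index>\<close>)

section \<open>Posets, ideal completions and domains\<close>

text \<open>Posets are the structures of \<^locale>\<open>partial_order\<close>: a carrier with an order relation.
  The library set \<^term>\<open>Upper L A\<close> of upper bounds lies inside \<^term>\<open>carrier L\<close>, so
  \<^term>\<open>least L s (Upper L A)\<close> says that \<^term>\<open>s\<close> is the least upper bound of \<^term>\<open>A\<close> in the poset.\<close>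

definition directed_subset :: "('a, 'b) gorder_scheme \<Rightarrow> 'a set \<Rightarrow> bool" where
  "directed_subset L A \<longleftrightarrow> A \<subseteq> carrier L \<and> A \<noteq> {} \<and>
     (\<forall>x\<in>A. \<forall>y\<in>A. \<exists>z\<in>A. x \<sqsubseteq>\<^bsub>L\<^esub> z \<and> y \<sqsubseteq>\<^bsub>L\<^esub> z)"

definition order_ideal :: "('a, 'b) gorder_scheme \<Rightarrow> 'a set \<Rightarrow> bool" where
  "order_ideal L I \<longleftrightarrow> directed_subset L I \<and>
     (\<forall>x\<in>I. \<forall>y\<in>carrier L. y \<sqsubseteq>\<^bsub>L\<^esub> x \<longrightarrow> y \<in> I)"

definition ideal_completion :: "('a, 'b) gorder_scheme \<Rightarrow> 'a set gorder" where
  "ideal_completion L = \<lparr>carrier = {I. order_ideal L I}, eq = (=), le = (\<subseteq>)\<rparr>"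

definition cusl :: "('a, 'b) gorder_scheme \<Rightarrow> bool" where
  "cusl L \<longleftrightarrow> partial_order L \<and> (\<exists>b. least L b (carrier L)) \<and>
     (\<forall>x\<in>carrier L. \<forall>y\<in>carrier L.
        Upper L {x, y} \<noteq> {} \<longrightarrow> (\<exists>s. least L s (Upper L {x, y})))"

definition bounded_complete :: "('a, 'b) gorder_scheme \<Rightarrow> bool" where
  "bounded_complete L \<longleftrightarrow> partial_order L \<and>
     (\<forall>A. A \<subseteq> carrier L \<longrightarrow> Upper L A \<noteq> {} \<longrightarrow> (\<exists>s. least L s (Upper L A)))"

definition dcpo :: "('a, 'b) gorder_scheme \<Rightarrow> bool" where
  "dcpo L \<longleftrightarrow> partial_order L \<and>
     (\<forall>A. directed_subset L A \<longrightarrow> (\<exists>s. least L s (Upper L A)))"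

definition pointed_dcpo :: "('a, 'b) gorder_scheme \<Rightarrow> bool" where
  "pointed_dcpo L \<longleftrightarrow> dcpo L \<and> (\<exists>b. least L b (carrier L))"

definition compact_elements :: "('a, 'b) gorder_scheme \<Rightarrow> 'a set" where
  "compact_elements L = {c \<in> carrier L.
     \<forall>A s. directed_subset L A \<longrightarrow> least L s (Upper L A) \<longrightarrow> c \<sqsubseteq>\<^bsub>L\<^esub> s \<longrightarrow> (\<exists>a\<in>A. c \<sqsubseteq>\<^bsub>L\<^esub> a)}"

definition omega_algebraic :: "('a, 'b) gorder_scheme \<Rightarrow> bool" where
  "omega_algebraic L \<longleftrightarrow> countable (compact_elements L) \<and>
     (\<forall>x\<in>carrier L. let C = {c \<in> compact_elements L. c \<sqsubseteq>\<^bsub>L\<^esub> x} in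
        directed_subset L C \<and> least L x (Upper L C))"

definition domain_poset :: "('a, 'b) gorder_scheme \<Rightarrow> bool" where
  "domain_poset L \<longleftrightarrow> pointed_dcpo L \<and> omega_algebraic L"


section \<open>Ternary sequences\<close>

text \<open>\<^term>\<open>Bit False\<close> and \<^term>\<open>Bit True\<close> are the digits 0 and 1.\<close>

datatype tern = Bot | Bit bool

instantiation tern :: order
begin

definition less_eq_tern :: "tern \<Rightarrow> tern \<Rightarrow> bool" where
  "c \<le> d \<longleftrightarrow> c = Bot \<or> c = d"

definition less_tern :: "tern \<Rightarrow> tern \<Rightarrow> bool" where
  "c < d \<longleftrightarrow> c \<le> d \<and> c \<noteq> (d :: tern)"

instance
  by standard (auto simp: less_eq_tern_def less_tern_def)

end

text \<open>Sequences are functions \<^typ>\<open>nat \<Rightarrow> tern\<close>; their library order is the pointwise one, which is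
  the product order.\<close>

definition trunc :: "(nat \<Rightarrow> tern) \<Rightarrow> nat \<Rightarrow> (nat \<Rightarrow> tern)" where
  "trunc p m = (\<lambda>k. if k < m then p k else Bot)"


section \<open>Dyadic subbases\<close>

definition regular_openin :: "'a topology \<Rightarrow> 'a set \<Rightarrow> bool" where
  "regular_openin X U \<longleftrightarrow> openin X U \<and> U = X interior_of (X closure_of U)"

text \<open>The relativisation to \<^term>\<open>topspace X\<close> makes the empty intersection the whole space.\<close>

definition is_subbase :: "'a topology \<Rightarrow> 'a set set \<Rightarrow> bool" where
  "is_subbase X \<B> \<longleftrightarrow>
     openin X = arbitrary union_of (finite intersection_of (\<lambda>U. U \<in> \<B>) relative_to topspace X)"

definition dyadic_subbase :: "'a topology \<Rightarrow> (nat \<Rightarrow> bool \<Rightarrow> 'a set) \<Rightarrow> bool" where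
  "dyadic_subbase X S \<longleftrightarrow>
     (\<forall>n a. regular_openin X (S n a)) \<and>
     is_subbase X {S n a |n a. True} \<and>
     (\<forall>n. S n True = topspace X - X closure_of (S n False))"

fun cell :: "'a topology \<Rightarrow> (nat \<Rightarrow> bool \<Rightarrow> 'a set) \<Rightarrow> nat \<Rightarrow> tern \<Rightarrow> 'a set" where
  "cell X S n (Bit a) = S n a"
| "cell X S n Bot = topspace X - (S n False \<union> S n True)"

definition tilde :: "'a topology \<Rightarrow> (nat \<Rightarrow> bool \<Rightarrow> 'a set) \<Rightarrow> 'a \<Rightarrow> (nat \<Rightarrow> tern)" where
  "tilde X S x = (\<lambda>n. THE c. x \<in> cell X S n c)"

lemma dyadic_subbase_disjoint:
  assumes "dyadic_subbase X S"
  shows "S n False \<inter> S n True = {}"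
proof -
  have "openin X (S n False)" and "S n True = topspace X - X closure_of (S n False)"
    using assms by (auto simp: dyadic_subbase_def regular_openin_def)
  then show ?thesis
    using closure_of_subset[OF openin_subset, of X "S n False"] by auto
qed

lemma tilde_eq_iff:
  assumes "dyadic_subbase X S" and "x \<in> topspace X"
  shows "tilde X S x n = c \<longleftrightarrow> x \<in> cell X S n c"
proof -
  have "\<exists>!c. x \<in> cell X S n c"
  proof (rule ex_ex1I)
    show "\<exists>c. x \<in> cell X S n c"
      using assms(2) cell.simps(1)[of X S n False] cell.simps(1)[of X S n True] cell.simps(2)[of X S n]
      by blast
  next
    fix c d
    assume "x \<in> cell X S n c" "x \<in> cell X S n d"
    moreover have "x \<notin> S n False \<or> x \<notin> S n True"
      using dyadic_subbase_disjoint[OF assms(1), of n] by auto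
    ultimately show "c = d"
      by (cases c; cases d) (auto, (metis (full_types))+)
  qed
  then show ?thesis
    unfolding tilde_def by (auto intro: theI' the1_equality)
qed

definition up_tilde :: "'a topology \<Rightarrow> (nat \<Rightarrow> bool \<Rightarrow> 'a set) \<Rightarrow> (nat \<Rightarrow> tern) set" where
  "up_tilde X S = {p. \<exists>q \<in> tilde X S ` topspace X. q \<le> p}"

definition K_hat :: "'a topology \<Rightarrow> (nat \<Rightarrow> bool \<Rightarrow> 'a set) \<Rightarrow> (nat \<Rightarrow> tern) gorder" where
  "K_hat X S = \<lparr>carrier = {trunc p m |p m. p \<in> up_tilde X S}, eq = (=), le = (\<le>)\<rparr>"

definition D_hat :: "'a topology \<Rightarrow> (nat \<Rightarrow> bool \<Rightarrow> 'a set) \<Rightarrow> (nat \<Rightarrow> tern) set gorder" where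
  "D_hat X S = ideal_completion (K_hat X S)"

end

theory Submission
  imports Defs
begin

text \<open>Two observations carry the proof.

  If two elements \<open>trunc p k\<close> and \<open>trunc q l\<close> of \<^term>\<open>K_hat X S\<close> with \<open>l \<le> k\<close> are compatible in the
  product order, then their pointwise join, continued by \<open>p\<close> from position \<open>k\<close> on, lies above
  \<open>p\<close> and hence in \<^term>\<open>up_tilde X S\<close>; cutting it at \<open>k\<close> gives back the join. So \<^term>\<open>K_hat X S\<close>
  is closed under the joins of compatible pairs (lemma \<open>tern_join_in_K_hat\<close>), and it is a cusl. It
  is countable because its elements are finite ternary words padded with \<^term>\<open>Bot\<close>.

  The rest is order theory. In the ideal completion of any poset directed suprema are unions and
  the compact elements are exactly the principal ideals, so the completion of a countable poset
  with a least element is a domain. If the poset is a cusl, an intersection of a nonempty family of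
  ideals is again an ideal, since the least upper bound of two common elements lies in every member
  of the family. The supremum of a bounded set of ideals is then the intersection of all its upper
  bounds.\<close>

section \<open>The ideal completion of a poset\<close>

lemma ideal_completion_simps [simp]:
  "carrier (ideal_completion L) = {I. order_ideal L I}"
  "le (ideal_completion L) = (\<subseteq>)"
  "eq (ideal_completion L) = (=)"
  by (simp_all add: ideal_completion_def)

lemma partial_order_ideal_completion: "partial_order (ideal_completion L)"
  by unfold_locales auto

lemma order_ideal_subset_carrier: "order_ideal L I \<Longrightarrow> I \<subseteq> carrier L"
  by (simp add: order_ideal_def directed_subset_def)

lemma order_ideal_downward:
  "order_ideal L I \<Longrightarrow> x \<in> I \<Longrightarrow> y \<in> carrier L \<Longrightarrow> y \<sqsubseteq>\<^bsub>L\<^esub> x \<Longrightarrow> y \<in> I"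
  by (auto simp: order_ideal_def)

lemma order_ideal_directed:
  assumes "order_ideal L I" "x \<in> I" "y \<in> I"
  obtains z where "z \<in> I" "x \<sqsubseteq>\<^bsub>L\<^esub> z" "y \<sqsubseteq>\<^bsub>L\<^esub> z"
  using assms unfolding order_ideal_def directed_subset_def by blast

lemma least_Upper_ideal_completion_iff:
  assumes "A \<subseteq> {I. order_ideal L I}"
  shows "least (ideal_completion L) J (Upper (ideal_completion L) A) \<longleftrightarrow>
    order_ideal L J \<and> (\<forall>I\<in>A. I \<subseteq> J) \<and>
    (\<forall>J'. order_ideal L J' \<longrightarrow> (\<forall>I\<in>A. I \<subseteq> J') \<longrightarrow> J \<subseteq> J')"
proof -
  have "Upper (ideal_completion L) A = {J. order_ideal L J \<and> (\<forall>I\<in>A. I \<subseteq> J)}"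
    using assms unfolding Upper_def ideal_completion_simps by blast
  then show ?thesis
    by (simp add: least_def) blast
qed

lemma order_ideal_directed_Union:
  assumes "directed_subset (ideal_completion L) A"
  shows "order_ideal L (\<Union>A)"
proof -
  have ideals: "order_ideal L I" if "I \<in> A" for I
    using assms that by (auto simp: directed_subset_def)
  have "A \<noteq> {}"
    using assms by (simp add: directed_subset_def)
  then have nonempty: "\<Union>A \<noteq> {}"
    using ideals by (auto simp: order_ideal_def directed_subset_def)
  have upper: "\<exists>z\<in>\<Union>A. x \<sqsubseteq>\<^bsub>L\<^esub> z \<and> y \<sqsubseteq>\<^bsub>L\<^esub> z" if "x \<in> \<Union>A" "y \<in> \<Union>A" for x y
  proof -
    obtain I I' where "I \<in> A" "x \<in> I" "I' \<in> A" "y \<in> I'"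
      using \<open>x \<in> \<Union>A\<close> \<open>y \<in> \<Union>A\<close> by blast
    moreover from this obtain J where "J \<in> A" "I \<subseteq> J" "I' \<subseteq> J"
      using assms unfolding directed_subset_def ideal_completion_simps by blast
    ultimately show ?thesis
      using order_ideal_directed[OF ideals, of J x y] by blast
  qed
  show ?thesis
    unfolding order_ideal_def directed_subset_def
    using ideals nonempty upper order_ideal_subset_carrier[OF ideals] order_ideal_downward[OF ideals]
    by blast
qed

lemma least_Upper_directed_Union:
  assumes "directed_subset (ideal_completion L) A"
  shows "least (ideal_completion L) (\<Union>A) (Upper (ideal_completion L) A)"
proof -
  have "A \<subseteq> {I. order_ideal L I}"
    using assms by (simp add: directed_subset_def)
  then show ?thesis
    using order_ideal_directed_Union[OF assms]
    by (auto simp: least_Upper_ideal_completion_iff)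
qed

lemma dcpo_ideal_completion: "dcpo (ideal_completion L)"
  unfolding dcpo_def using partial_order_ideal_completion least_Upper_directed_Union by blast

text \<open>The principal ideal of an element; it contains the element only if that lies in the
  carrier.\<close>

definition principal_ideal :: "('a, 'b) gorder_scheme \<Rightarrow> 'a \<Rightarrow> 'a set" where
  "principal_ideal L a = {x \<in> carrier L. x \<sqsubseteq>\<^bsub>L\<^esub> a}"

context partial_order
begin

lemma mem_principal_ideal: "a \<in> carrier L \<Longrightarrow> a \<in> principal_ideal L a"
  by (simp add: principal_ideal_def)

lemma order_ideal_principal_ideal:
  assumes "a \<in> carrier L"
  shows "order_ideal L (principal_ideal L a)"
proof -
  have "directed_subset L (principal_ideal L a)"
    using assms by (auto simp: directed_subset_def principal_ideal_def)
  then show ?thesis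
    using assms by (auto simp: order_ideal_def principal_ideal_def intro: le_trans)
qed

lemma principal_ideal_subset_iff:
  assumes "order_ideal L I" "a \<in> carrier L"
  shows "principal_ideal L a \<subseteq> I \<longleftrightarrow> a \<in> I"
  using assms mem_principal_ideal order_ideal_downward[OF assms(1)]
  by (auto simp: principal_ideal_def)

text \<open>This and the next lemma make every ideal the directed supremum of the principal ideals of its
  elements.\<close>

lemma directed_principal_ideals:
  assumes "order_ideal L I"
  shows "directed_subset (ideal_completion L) (principal_ideal L ` I)"
proof -
  have sub: "I \<subseteq> carrier L"
    using assms by (rule order_ideal_subset_carrier)
  have "\<exists>z\<in>I. principal_ideal L x \<subseteq> principal_ideal L z \<and> principal_ideal L y \<subseteq> principal_ideal L z"
    if xy: "x \<in> I" "y \<in> I" for x y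
  proof -
    obtain z where "z \<in> I" "x \<sqsubseteq> z" "y \<sqsubseteq> z"
      using order_ideal_directed[OF assms xy] .
    then have "x \<in> principal_ideal L z" "y \<in> principal_ideal L z" "z \<in> carrier L"
      using sub xy by (auto simp: principal_ideal_def)
    then show ?thesis
      using \<open>z \<in> I\<close> principal_ideal_subset_iff[OF order_ideal_principal_ideal] sub xy by blast
  qed
  moreover have "I \<noteq> {}"
    using assms by (simp add: order_ideal_def directed_subset_def)
  ultimately show ?thesis
    using sub order_ideal_principal_ideal by (auto simp: directed_subset_def)
qed

lemma Union_principal_ideals:
  assumes "order_ideal L I"
  shows "\<Union>(principal_ideal L ` I) = I"
proof (intro subset_antisym subsetI)
  fix x assume "x \<in> \<Union>(principal_ideal L ` I)"
  then show "x \<in> I"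
    using order_ideal_downward[OF assms] by (auto simp: principal_ideal_def)
next
  fix x assume "x \<in> I"
  then show "x \<in> \<Union>(principal_ideal L ` I)"
    using order_ideal_subset_carrier[OF assms] mem_principal_ideal by blast
qed

lemma compact_elements_ideal_completion:
  "compact_elements (ideal_completion L) = principal_ideal L ` carrier L"
proof (intro subset_antisym subsetI)
  fix I assume I: "I \<in> compact_elements (ideal_completion L)"
  then have ideal: "order_ideal L I"
    by (simp add: compact_elements_def)
  have sup: "least (ideal_completion L) I (Upper (ideal_completion L) (principal_ideal L ` I))"
    using least_Upper_directed_Union[OF directed_principal_ideals[OF ideal]]
    by (simp only: Union_principal_ideals[OF ideal])
  \<comment> \<open>Compactness, applied to the principal ideals below \<open>I\<close>, gives a greatest element of \<open>I\<close>.\<close>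
  have "\<exists>J\<in>A. I \<subseteq> J"
    if "directed_subset (ideal_completion L) A"
      and "least (ideal_completion L) s (Upper (ideal_completion L) A)" and "I \<subseteq> s" for A s
    using I that by (simp add: compact_elements_def)
  from this[OF directed_principal_ideals[OF ideal] sup subset_refl]
  obtain a where "a \<in> I" "I \<subseteq> principal_ideal L a"
    by blast
  moreover have "a \<in> carrier L"
    using \<open>a \<in> I\<close> order_ideal_subset_carrier[OF ideal] by blast
  ultimately show "I \<in> principal_ideal L ` carrier L"
    using principal_ideal_subset_iff[OF ideal] by blast
next
  fix I assume "I \<in> principal_ideal L ` carrier L"
  then obtain a where a: "a \<in> carrier L" and I: "I = principal_ideal L a"
    by blast
  have "\<exists>J\<in>A. I \<subseteq> J"
    if dir: "directed_subset (ideal_completion L) A"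
      and sup: "least (ideal_completion L) s (Upper (ideal_completion L) A)" and "I \<subseteq> s" for A s
  proof -
    have ideals: "A \<subseteq> {J. order_ideal L J}"
      using dir by (simp add: directed_subset_def)
    have "s \<subseteq> \<Union>A"
      using sup order_ideal_directed_Union[OF dir]
      by (auto simp: least_Upper_ideal_completion_iff[OF ideals])
    then obtain J where "J \<in> A" "a \<in> J"
      using \<open>I \<subseteq> s\<close> mem_principal_ideal[OF a] I by blast
    then show ?thesis
      using ideals principal_ideal_subset_iff[OF _ a] I by blast
  qed
  then show "I \<in> compact_elements (ideal_completion L)"
    using order_ideal_principal_ideal[OF a] I by (simp add: compact_elements_def)
qed

lemma omega_algebraic_ideal_completion:
  assumes "countable (carrier L)"
  shows "omega_algebraic (ideal_completion L)"
proof -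
  have "{c \<in> principal_ideal L ` carrier L. c \<subseteq> I} = principal_ideal L ` I"
    if I: "order_ideal L I" for I
    using principal_ideal_subset_iff[OF I] order_ideal_subset_carrier[OF I] by blast
  then show ?thesis
    using assms directed_principal_ideals least_Upper_directed_Union[OF directed_principal_ideals]
    by (simp add: omega_algebraic_def compact_elements_ideal_completion Union_principal_ideals)
qed

lemma least_mem_order_ideal:
  assumes "order_ideal L I" "least L b (carrier L)"
  shows "b \<in> I"
proof -
  obtain x where "x \<in> I"
    using assms(1) by (auto simp: order_ideal_def directed_subset_def)
  then show ?thesis
    using assms order_ideal_downward[OF assms(1)] order_ideal_subset_carrier[OF assms(1)]
    by (auto simp: least_def)
qed

lemma pointed_dcpo_ideal_completion:
  assumes "least L b (carrier L)"
  shows "pointed_dcpo (ideal_completion L)"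
proof -
  have b: "b \<in> carrier L"
    using assms by (simp add: least_def)
  then have "least (ideal_completion L) (principal_ideal L b) (carrier (ideal_completion L))"
    using order_ideal_principal_ideal[OF b] principal_ideal_subset_iff[OF _ b]
      least_mem_order_ideal[OF _ assms]
    by (auto simp: least_def)
  then show ?thesis
    using dcpo_ideal_completion by (auto simp: pointed_dcpo_def)
qed

end

lemma domain_poset_ideal_completion:
  assumes "cusl L" "countable (carrier L)"
  shows "domain_poset (ideal_completion L)"
proof -
  interpret partial_order L
    using assms(1) by (simp add: cusl_def)
  obtain b where "least L b (carrier L)"
    using assms(1) by (auto simp: cusl_def)
  then show ?thesis
    using pointed_dcpo_ideal_completion omega_algebraic_ideal_completion[OF assms(2)]
    by (simp add: domain_poset_def)
qed

lemma order_ideal_Inter: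
  assumes "cusl L" "F \<noteq> {}" and ideals: "\<And>I. I \<in> F \<Longrightarrow> order_ideal L I"
  shows "order_ideal L (\<Inter>F)"
proof -
  interpret partial_order L
    using assms(1) by (simp add: cusl_def)
  have sub: "\<Inter>F \<subseteq> carrier L"
    using \<open>F \<noteq> {}\<close> order_ideal_subset_carrier[OF ideals] by blast
  obtain b where "least L b (carrier L)"
    using assms(1) by (auto simp: cusl_def)
  then have "\<Inter>F \<noteq> {}"
    using least_mem_order_ideal[OF ideals] by blast
  moreover have "\<exists>z\<in>\<Inter>F. x \<sqsubseteq>\<^bsub>L\<^esub> z \<and> y \<sqsubseteq>\<^bsub>L\<^esub> z" if xy: "x \<in> \<Inter>F" "y \<in> \<Inter>F" for x y
  proof -
    have carrier: "x \<in> carrier L" "y \<in> carrier L"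
      using xy sub by auto
    have bound: "\<exists>w\<in>I. w \<in> Upper L {x, y}" if I: "I \<in> F" for I
    proof -
      obtain w where "w \<in> I" "x \<sqsubseteq>\<^bsub>L\<^esub> w" "y \<sqsubseteq>\<^bsub>L\<^esub> w"
        using order_ideal_directed[OF ideals[OF I], of x y] xy I by blast
      then show ?thesis
        using order_ideal_subset_carrier[OF ideals[OF I]] by (auto simp: Upper_def)
    qed
    then obtain z where z: "least L z (Upper L {x, y})"
      using assms(1) carrier \<open>F \<noteq> {}\<close> unfolding cusl_def by blast
    have "z \<in> I" if "I \<in> F" for I
      using bound[OF that] z order_ideal_downward[OF ideals[OF that]]
      by (auto simp: least_def Upper_def)
    moreover have "x \<sqsubseteq>\<^bsub>L\<^esub> z" "y \<sqsubseteq>\<^bsub>L\<^esub> z"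
      using z carrier by (auto simp: least_def Upper_def)
    ultimately show ?thesis
      by blast
  qed
  ultimately show ?thesis
    using sub order_ideal_downward[OF ideals] unfolding order_ideal_def directed_subset_def by blast
qed

lemma bounded_complete_ideal_completion:
  assumes "cusl L"
  shows "bounded_complete (ideal_completion L)"
proof -
  have "least (ideal_completion L) (\<Inter>(Upper (ideal_completion L) A)) (Upper (ideal_completion L) A)"
    if A: "A \<subseteq> {I. order_ideal L I}" and "Upper (ideal_completion L) A \<noteq> {}" for A
  proof -
    have "order_ideal L (\<Inter>(Upper (ideal_completion L) A))"
      using that by (intro order_ideal_Inter[OF assms]) (auto simp: Upper_def)
    then show ?thesis
      using A by (subst least_Upper_ideal_completion_iff[OF A]) (auto simp: Upper_def)
  qed
  then show ?thesis
    using partial_order_ideal_completion by (auto simp: bounded_complete_def)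
qed


section \<open>Joins and truncations of ternary sequences\<close>

text \<open>The pointwise join of two sequences. It is meaningful for compatible sequences only; on a
  position where they carry different digits it takes the digit of the first.\<close>

definition tern_join :: "(nat \<Rightarrow> tern) \<Rightarrow> (nat \<Rightarrow> tern) \<Rightarrow> (nat \<Rightarrow> tern)" where
  "tern_join p q = (\<lambda>n. if p n = Bot then q n else p n)"

lemma tern_join_ge1: "p \<le> tern_join p q"
  by (auto simp: le_fun_def tern_join_def less_eq_tern_def)

lemma tern_join_ge2:
  assumes "p \<le> r" "q \<le> r"
  shows "q \<le> tern_join p q"
proof (rule le_funI)
  fix n
  show "q n \<le> tern_join p q n"
    using le_funD[OF assms(1), of n] le_funD[OF assms(2), of n]
    by (auto simp: tern_join_def less_eq_tern_def)
qed

lemma tern_join_least: "p \<le> r \<Longrightarrow> q \<le> r \<Longrightarrow> tern_join p q \<le> r"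
  by (auto simp: le_fun_def tern_join_def)

lemma tern_join_commute:
  assumes "p \<le> r" "q \<le> r"
  shows "tern_join p q = tern_join q p"
  using tern_join_ge1 tern_join_ge2[OF assms] tern_join_ge2[OF assms(2,1)]
  by (intro order_antisym tern_join_least)

lemma countable_range_trunc: "countable {trunc p m |p m. True}"
proof -
  have "{trunc p m |p m. True} \<subseteq> range (\<lambda>xs k. if k < length xs then xs ! k else Bot)"
  proof clarify
    fix p m
    have "trunc p m = (\<lambda>k. if k < length (map p [0..<m]) then map p [0..<m] ! k else Bot)"
      by (auto simp: trunc_def)
    then show "trunc p m \<in> range (\<lambda>xs k. if k < length xs then xs ! k else Bot)"
      by blast
  qed
  moreover have "countable (UNIV :: tern set)"
  proof -
    have "(UNIV :: tern set) = {Bot, Bit False, Bit True}"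
      by (auto, metis (full_types) tern.exhaust)
    then show ?thesis
      by (metis countable_empty countable_insert)
  qed
  then have "countable (UNIV :: tern list set)"
    by (metis countable_lists lists_UNIV)
  ultimately show ?thesis
    by (blast intro: countable_subset countable_image)
qed


section \<open>The poset of truncations of a dyadic subbase\<close>

lemma K_hat_simps [simp]:
  "carrier (K_hat X S) = {trunc p m |p m. p \<in> up_tilde X S}"
  "le (K_hat X S) = (\<le>)"
  "eq (K_hat X S) = (=)"
  by (simp_all add: K_hat_def)

lemma partial_order_K_hat: "partial_order (K_hat X S)"
  by unfold_locales auto

lemma up_tilde_upward: "p \<in> up_tilde X S \<Longrightarrow> p \<le> q \<Longrightarrow> q \<in> up_tilde X S"
  unfolding up_tilde_def by (blast intro: order_trans)

lemma trunc_join_in_K_hat: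
  assumes "p \<in> up_tilde X S" "l \<le> k"
  shows "tern_join (trunc p k) (trunc q l) \<in> carrier (K_hat X S)"
proof -
  \<comment> \<open>The tail of \<open>p\<close> makes the sequence lie above \<open>p\<close>, although the join itself need not lie
    above any point.\<close>
  define s where "s = tern_join p (trunc q l)"
  have "trunc s k = tern_join (trunc p k) (trunc q l)"
    using assms(2) by (auto simp: s_def trunc_def tern_join_def)
  moreover have "s \<in> up_tilde X S"
    using up_tilde_upward[OF assms(1)] tern_join_ge1 by (simp add: s_def)
  ultimately show ?thesis
    by (metis (mono_tags, lifting) K_hat_simps(1) mem_Collect_eq)
qed

lemma tern_join_in_K_hat:
  assumes "e \<in> carrier (K_hat X S)" "f \<in> carrier (K_hat X S)" and bound: "e \<le> r" "f \<le> r"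
  shows "tern_join e f \<in> carrier (K_hat X S)"
proof -
  obtain p k q l where e: "e = trunc p k" and p: "p \<in> up_tilde X S"
    and f: "f = trunc q l" and q: "q \<in> up_tilde X S"
    using assms by auto
  show ?thesis
  proof (cases "l \<le> k")
    case True
    then show ?thesis
      unfolding e f using p by (rule trunc_join_in_K_hat[rotated])
  next
    case False
    then have "tern_join f e \<in> carrier (K_hat X S)"
      unfolding e f by (intro trunc_join_in_K_hat[OF q]) simp
    then show ?thesis
      by (subst tern_join_commute[OF bound])
  qed
qed

lemma cusl_K_hat:
  assumes "topspace X \<noteq> {}"
  shows "cusl (K_hat X S)"
proof -
  obtain x where "x \<in> topspace X"
    using assms by blast
  then have "tilde X S x \<in> up_tilde X S"
    by (auto simp: up_tilde_def)
  then have "trunc (tilde X S x) 0 \<in> carrier (K_hat X S)"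
    by auto
  moreover have "trunc (tilde X S x) 0 \<le> f" for f
    by (simp add: trunc_def le_fun_def less_eq_tern_def)
  ultimately have "least (K_hat X S) (trunc (tilde X S x) 0) (carrier (K_hat X S))"
    by (simp add: least_def del: K_hat_simps(1))
  moreover have "least (K_hat X S) (tern_join e f) (Upper (K_hat X S) {e, f})"
    if ef: "e \<in> carrier (K_hat X S)" "f \<in> carrier (K_hat X S)"
      and r: "r \<in> Upper (K_hat X S) {e, f}" for e f r
  proof -
    have U: "Upper (K_hat X S) {e, f} = {u \<in> carrier (K_hat X S). e \<le> u \<and> f \<le> u}"
      using ef unfolding Upper_def by (auto simp del: K_hat_simps(1))
    then have bound: "e \<le> r" "f \<le> r"
      using r by auto
    show ?thesis
      using tern_join_in_K_hat[OF ef bound] tern_join_ge1 tern_join_ge2[OF bound] tern_join_least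
      by (auto simp: least_def U simp del: K_hat_simps(1))
  qed
  ultimately show ?thesis
    unfolding cusl_def using partial_order_K_hat by blast
qed

lemma countable_carrier_K_hat: "countable (carrier (K_hat X S))"
  by (rule countable_subset[OF _ countable_range_trunc]) auto

theorem proposition4p4:
  fixes X :: "'a topology" and S :: "nat \<Rightarrow> bool \<Rightarrow> 'a set"
  assumes "topspace X \<noteq> {}"
    and "second_countable X"
    and "Hausdorff_space X"
    and "dyadic_subbase X S"
  shows "cusl (K_hat X S) \<and> (domain_poset (D_hat X S) \<and> bounded_complete (D_hat X S))"
  unfolding D_hat_def
  using cusl_K_hat[OF assms(1)] countable_carrier_K_hat domain_poset_ideal_completion
    bounded_complete_ideal_completion
  by blast

end
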